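(* Nash equilibria are not guaranteed to exist when firms aim to maximize their total assets: there exists a financial network (non-negative external assets, debt contracts only, no default costs) whose financial network game under priority-proportional strategies, with the utility of each firm being its total assets, has no (pure) Nash equilibrium.
   Context: Financial network: firms $v_1,\dots,v_n$; each $v_i$ has external assets $e_i\ge 0$; $v_i$ owes $v_j$ the liability $l_{ij}\ge 0$, with $l_{ii}=0$ (both $l_{ij}>0$ and $l_{ji}>0$ are allowed); $L_i=\sum_j l_{ij}$. Priority-proportional strategy: a strategy $s_i$ of $v_i$ is a complete ordering, allowing ties, of its creditors, i.e. an ordered partition of $\{v_j: l_{ij}>0\}$ into priority classes $1,2,\dots$. Write $L_i^{(m)}$ for the total liability of $v_i$ to its $m$-th class, $k_{ij}$ for the index of the class of $v_i$ containing $v_j$, and $\pi'_{ij}=l_{ij}/L_i^{(k_{ij})}$. Clearing payments consistent with a strategy profile $\mathbf{s}=(s_1,\dots,s_n)$: a matrix $\mathbf{P}=(p_{ij})$ with $p_{ii}=0$, $0\le p_{ij}\le l_{ij}$ and, writing $p_i=\sum_j p_{ij}$, for every $i$: $p_i=\min\{L_i,\,e_i+\sum_j p_{ji}\}$; moreover for every creditor $v_j$ of $v_i$, $$p_{ij}=\min\Big\{\max\Big\{\Big(p_i-\sum_{m=1}^{k_{ij}-1}L_i^{(m)}\Big)\pi'_{ij},\,0\Big\},\,l_{ij}\Big\},$$ and $p_{ij}=0$ if $l_{ij}=0$. Clearing payments are proper if every firm with a positive outgoing payment is reachable, by a (possibly trivial) directed path of edges $(v_i,v_j)$ with $p_{ij}>0$,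 from some firm with positive external assets. Only proper clearing payments are considered. For every profile $\mathbf{s}$ there are maximal ones, denoted $\mathbf{P}(\mathbf{s})$, which are entrywise at least as large as all other proper clearing payments consistent with $\mathbf{s}$. Total assets: $a_i(\mathbf{P})=e_i+\sum_j p_{ji}$. The utility of $v_i$ under $\mathbf{s}$ is $a_i(\mathbf{P}(\mathbf{s}))$. A profile is a (pure) Nash equilibrium if no firm can strictly increase its utility by unilaterally changing its priority-proportional strategy. *)

theory Defs
  imports Complex_Main "HOL-Library.Disjoint_Sets" "HOL-Library.FuncSet"
begin

record network =
  num_firms :: nat
  ext_assets :: "nat \<Rightarrow> real"
  liab :: "nat \<Rightarrow> nat \<Rightarrow> real"

definition firms :: "network \<Rightarrow> nat set" where
  "firms N = {1..num_firms N}"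

definition financial_network :: "network \<Rightarrow> bool" where
  "financial_network N \<longleftrightarrow>
     (\<forall>i\<in>firms N. 0 \<le> ext_assets N i \<and> liab N i i = 0 \<and> (\<forall>j\<in>firms N. 0 \<le> liab N i j))"

definition total_liability :: "network \<Rightarrow> nat \<Rightarrow> real" where
  "total_liability N i = (\<Sum>j\<in>firms N. liab N i j)"

definition creditors :: "network \<Rightarrow> nat \<Rightarrow> nat set" where
  "creditors N i = {j \<in> firms N. 0 < liab N i j}"

text \<open>A priority-proportional strategy is the list of the priority classes in decreasing order
  of priority. Classes are counted from 1, so class \<open>m\<close> of \<open>cs\<close> is \<open>cs ! (m - 1)\<close>.\<close>

definition strategies :: "network \<Rightarrow> nat \<Rightarrow> nat set list set" where
  "strategies N i = {cs. distinct cs \<and> partition_on (creditors N i) (set cs)}"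

definition profiles :: "network \<Rightarrow> (nat \<Rightarrow> nat set list) set" where
  "profiles N = Pi (firms N) (strategies N)"

definition class_index :: "nat set list \<Rightarrow> nat \<Rightarrow> nat" where
  "class_index cs j = (THE k. k \<in> {1..length cs} \<and> j \<in> cs ! (k - 1))"

definition class_liability :: "network \<Rightarrow> nat \<Rightarrow> nat set list \<Rightarrow> nat \<Rightarrow> real" where
  "class_liability N i cs m = (\<Sum>j\<in>cs ! (m - 1). liab N i j)"

definition outgoing :: "network \<Rightarrow> (nat \<Rightarrow> nat \<Rightarrow> real) \<Rightarrow> nat \<Rightarrow> real" where
  "outgoing N P i = (\<Sum>j\<in>firms N. P i j)"

definition total_assets :: "network \<Rightarrow> (nat \<Rightarrow> nat \<Rightarrow> real) \<Rightarrow> nat \<Rightarrow> real" where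
  "total_assets N P i = ext_assets N i + (\<Sum>j\<in>firms N. P j i)"

text \<open>Payment matrices are functions on all of \<open>nat \<times> nat\<close>; the first conjunct makes them vanish
  outside the set of firms, so that a matrix is determined by its entries.\<close>

definition clearing_payments :: "network \<Rightarrow> (nat \<Rightarrow> nat set list) \<Rightarrow> (nat \<Rightarrow> nat \<Rightarrow> real) \<Rightarrow> bool" where
  "clearing_payments N s P \<longleftrightarrow>
     (\<forall>i j. i \<notin> firms N \<or> j \<notin> firms N \<longrightarrow> P i j = 0) \<and>
     (\<forall>i\<in>firms N.
        P i i = 0 \<and>
        (\<forall>j\<in>firms N. 0 \<le> P i j \<and> P i j \<le> liab N i j) \<and>
        outgoing N P i = min (total_liability N i) (total_assets N P i) \<and>
        (\<forall>j\<in>creditors N i.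
           (let k = class_index (s i) j in
            P i j = min (max ((outgoing N P i - (\<Sum>m\<in>{1..<k}. class_liability N i (s i) m))
                              * (liab N i j / class_liability N i (s i) k)) 0)
                        (liab N i j))) \<and>
        (\<forall>j\<in>firms N. liab N i j = 0 \<longrightarrow> P i j = 0))"

definition payment_edges :: "network \<Rightarrow> (nat \<Rightarrow> nat \<Rightarrow> real) \<Rightarrow> (nat \<times> nat) set" where
  "payment_edges N P = {(i, j). i \<in> firms N \<and> j \<in> firms N \<and> 0 < P i j}"

definition proper :: "network \<Rightarrow> (nat \<Rightarrow> nat \<Rightarrow> real) \<Rightarrow> bool" where
  "proper N P \<longleftrightarrow>
     (\<forall>i\<in>firms N. 0 < outgoing N P i \<longrightarrow>
        (\<exists>h\<in>firms N. 0 < ext_assets N h \<and> (h, i) \<in> (payment_edges N P)\<^sup>*))"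

definition is_maximal_payments :: "network \<Rightarrow> (nat \<Rightarrow> nat set list) \<Rightarrow> (nat \<Rightarrow> nat \<Rightarrow> real) \<Rightarrow> bool" where
  "is_maximal_payments N s P \<longleftrightarrow>
     clearing_payments N s P \<and> proper N P \<and>
     (\<forall>Q. clearing_payments N s Q \<and> proper N Q \<longrightarrow> (\<forall>i j. Q i j \<le> P i j))"

definition maximal_payments :: "network \<Rightarrow> (nat \<Rightarrow> nat set list) \<Rightarrow> nat \<Rightarrow> nat \<Rightarrow> real" where
  "maximal_payments N s = (THE P. is_maximal_payments N s P)"

text \<open>Maximal proper clearing payments exist and are unique for every profile, so that the
  definite description in \<^const>\<open>maximal_payments\<close> is well-defined.\<close>

lemma is_maximal_payments_unique:
  assumes "is_maximal_payments N s P" "is_maximal_payments N s Q"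
  shows "P = Q"
  using assms by (auto simp: is_maximal_payments_def fun_eq_iff intro!: antisym)

text \<open>What \<open>i\<close> pays to \<open>j\<close> under the strategy \<open>cs\<close> if its outgoing payment is \<open>q\<close>.\<close>

definition split_payment :: "network \<Rightarrow> nat \<Rightarrow> nat set list \<Rightarrow> real \<Rightarrow> nat \<Rightarrow> real" where
  "split_payment N i cs q j =
     (if j \<in> creditors N i then
        (let k = class_index cs j in
         min (max ((q - (\<Sum>m\<in>{1..<k}. class_liability N i cs m))
                   * (liab N i j / class_liability N i cs k)) 0)
             (liab N i j))
      else 0)"

lemma finite_firms [simp]: "finite (firms N)"
  by (simp add: firms_def)

lemma sum_distinct_nth:
  assumes "distinct xs"
  shows "(\<Sum>A\<in>set xs. f A) = (\<Sum>m\<in>{1..length xs}. f (xs ! (m - 1)))"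
proof -
  have "(\<Sum>A\<in>set xs. f A) = (\<Sum>m\<in>{..<length xs}. f (xs ! m))"
    by (rule sum.reindex_bij_betw[symmetric, OF bij_betw_nth[OF assms]]) auto
  also have "\<dots> = (\<Sum>m\<in>{1..length xs}. f (xs ! (m - 1)))"
    by (rule sum.reindex_bij_witness[of _ "\<lambda>m. m - 1" Suc]) auto
  finally show ?thesis .
qed

lemma class_index_nth:
  assumes cs: "cs \<in> strategies N i" and m: "m \<in> {1..length cs}" and j: "j \<in> cs ! (m - 1)"
  shows "class_index cs j = m"
  unfolding class_index_def
proof (rule the_equality)
  show "m \<in> {1..length cs} \<and> j \<in> cs ! (m - 1)" using m j by simp
next
  fix k assume k: "k \<in> {1..length cs} \<and> j \<in> cs ! (k - 1)"
  have "disjoint (set cs)" "distinct cs"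
    using cs by (auto simp: strategies_def partition_on_def)
  moreover have "cs ! (k - 1) \<in> set cs" "cs ! (m - 1) \<in> set cs" using k m by auto
  ultimately have "cs ! (k - 1) = cs ! (m - 1)"
    using k j by (meson disjointD disjoint_iff)
  hence "k - 1 = m - 1"
    using \<open>distinct cs\<close> k m nth_eq_iff_index_eq[of cs "k - 1" "m - 1"] by auto
  thus "k = m" using k m by auto
qed

lemma class_split:
  fixes f :: "nat \<Rightarrow> real" and q :: real
  assumes "finite A" "\<And>j. j \<in> A \<Longrightarrow> 0 < f j" "A \<noteq> {}"
  shows "(\<Sum>j\<in>A. min (max (q * (f j / sum f A)) 0) (f j)) = min (max q 0) (sum f A)"
proof -
  let ?C = "sum f A"
  have C: "0 < ?C" using assms by (simp add: sum_pos)
  have "min (max (q * (f j / ?C)) 0) (f j) = min (max q 0) ?C / ?C * f j" if "j \<in> A" for j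
  proof -
    have fj: "0 < f j" using that assms by simp
    consider "q \<le> 0" | "0 < q" "q \<le> ?C" | "?C < q" by linarith
    thus ?thesis
    proof cases
      case 1
      hence "q * (f j / ?C) \<le> 0" using fj C by (intro mult_nonpos_nonneg) auto
      thus ?thesis using 1 fj C by (simp add: min_def max_def)
    next
      case 2
      have "0 < q * (f j / ?C)" using 2 fj C by simp
      moreover have "q * (f j / ?C) \<le> f j" using 2 fj C by (simp add: field_simps)
      ultimately show ?thesis using 2 by (simp add: min_def max_def)
    next
      case 3
      have "0 < q * (f j / ?C)" using 3 fj C by simp
      moreover have "f j < q * (f j / ?C)" using 3 fj C by (simp add: field_simps)
      ultimately show ?thesis using 3 C by (simp add: min_def max_def)
    qed
  qed
  hence "(\<Sum>j\<in>A. min (max (q * (f j / ?C)) 0) (f j)) = (\<Sum>j\<in>A. min (max q 0) ?C / ?C * f j)"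
    by (rule sum.cong[OF refl])
  also have "\<dots> = min (max q 0) ?C / ?C * ?C" by (rule sum_distrib_left[symmetric])
  also have "\<dots> = min (max q 0) ?C" using C by simp
  finally show ?thesis .
qed

lemma layer_sum:
  fixes c :: "nat \<Rightarrow> real"
  assumes "0 \<le> q" "\<And>m. m \<in> {1..n} \<Longrightarrow> 0 \<le> c m"
  shows "(\<Sum>m\<in>{1..n}. min (max (q - sum c {1..<m}) 0) (c m)) = min q (sum c {1..n})"
  using assms(2)
proof (induction n)
  case 0
  thus ?case using assms(1) by simp
next
  case (Suc n)
  have "{1..<Suc n} = {1..n}" by auto
  moreover have "0 \<le> c (Suc n)" using Suc.prems by simp
  moreover have "(\<Sum>m\<in>{1..n}. min (max (q - sum c {1..<m}) 0) (c m)) = min q (sum c {1..n})"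
    using Suc by simp
  moreover have "min q S + min (max (q - S) 0) x = min q (S + x)" if "0 \<le> x" for S x :: real
    using that by (auto simp: min_def max_def)
  ultimately show ?case by simp
qed

lemma total_liability_classes:
  assumes N: "financial_network N" and i: "i \<in> firms N" and cs: "cs \<in> strategies N i"
  shows "total_liability N i = (\<Sum>m\<in>{1..length cs}. class_liability N i cs m)"
    and "(\<Sum>j\<in>creditors N i. g j) = (\<Sum>m\<in>{1..length cs}. \<Sum>j\<in>cs ! (m - 1). g j)"
proof -
  have fin: "finite (creditors N i)" by (simp add: creditors_def)
  have part: "partition_on (creditors N i) (set cs)" "distinct cs"
    using cs by (auto simp: strategies_def)
  have *: "(\<Sum>j\<in>creditors N i. h j) = (\<Sum>m\<in>{1..length cs}. \<Sum>j\<in>cs ! (m - 1). h j)"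
    for h :: "nat \<Rightarrow> 'z::comm_monoid_add"
  proof -
    have "(\<Sum>j\<in>creditors N i. h j) = (\<Sum>j\<in>\<Union>(set cs). h j)"
      using part by (simp add: partition_on_def)
    also have "\<dots> = (\<Sum>A\<in>set cs. \<Sum>j\<in>A. h j)"
      using part fin
      by (subst sum.Union_disjoint)
         (auto simp: partition_on_def disjoint_def intro: finite_subset)
    also have "\<dots> = (\<Sum>m\<in>{1..length cs}. \<Sum>j\<in>cs ! (m - 1). h j)"
      by (rule sum_distinct_nth[OF part(2)])
    finally show ?thesis .
  qed
  from * show "(\<Sum>j\<in>creditors N i. g j) = (\<Sum>m\<in>{1..length cs}. \<Sum>j\<in>cs ! (m - 1). g j)" .
  have "total_liability N i = (\<Sum>j\<in>creditors N i. liab N i j)"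
    unfolding total_liability_def
    by (rule sum.mono_neutral_right)
       (use N i in \<open>auto simp: creditors_def financial_network_def intro: order_antisym\<close>)
  thus "total_liability N i = (\<Sum>m\<in>{1..length cs}. class_liability N i cs m)"
    using * by (simp add: class_liability_def)
qed

lemma sum_split_payment:
  assumes N: "financial_network N" and i: "i \<in> firms N" and cs: "cs \<in> strategies N i"
    and q: "0 \<le> q" "q \<le> total_liability N i"
  shows "(\<Sum>j\<in>firms N. split_payment N i cs q j) = q"
proof -
  let ?c = "class_liability N i cs"
  have fin: "finite (creditors N i)" by (simp add: creditors_def)
  have sub: "cs ! (m - 1) \<subseteq> creditors N i" "cs ! (m - 1) \<noteq> {}" if "m \<in> {1..length cs}" for m
  proof -
    have "cs ! (m - 1) \<in> set cs" using that by auto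
    thus "cs ! (m - 1) \<subseteq> creditors N i" "cs ! (m - 1) \<noteq> {}"
      using cs by (auto simp: strategies_def partition_on_def)
  qed
  have "(\<Sum>j\<in>firms N. split_payment N i cs q j) = (\<Sum>j\<in>creditors N i. split_payment N i cs q j)"
    by (rule sum.mono_neutral_right) (auto simp: creditors_def split_payment_def)
  also have "\<dots> = (\<Sum>m\<in>{1..length cs}. \<Sum>j\<in>cs ! (m - 1). split_payment N i cs q j)"
    by (rule total_liability_classes(2)[OF N i cs])
  also have "\<dots> = (\<Sum>m\<in>{1..length cs}. min (max (q - sum ?c {1..<m}) 0) (?c m))"
  proof (rule sum.cong[OF refl])
    fix m assume m: "m \<in> {1..length cs}"
    have "(\<Sum>j\<in>cs ! (m - 1). split_payment N i cs q j) =
      (\<Sum>j\<in>cs ! (m - 1). min (max ((q - sum ?c {1..<m}) * (liab N i j / ?c m)) 0) (liab N i j))"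
    proof (rule sum.cong[OF refl])
      fix j assume j: "j \<in> cs ! (m - 1)"
      show "split_payment N i cs q j =
        min (max ((q - sum ?c {1..<m}) * (liab N i j / ?c m)) 0) (liab N i j)"
        using sub[OF m] j class_index_nth[OF cs m j] by (auto simp: split_payment_def Let_def)
    qed
    also have "\<dots> = min (max (q - sum ?c {1..<m}) 0) (?c m)"
      unfolding class_liability_def[of N i cs m]
      by (rule class_split)
         (use sub[OF m] finite_subset[OF sub(1)[OF m] fin] in \<open>auto simp: creditors_def\<close>)
    finally show "(\<Sum>j\<in>cs ! (m - 1). split_payment N i cs q j) =
      min (max (q - sum ?c {1..<m}) 0) (?c m)" .
  qed
  also have "\<dots> = min q (sum ?c {1..length cs})"
  proof (rule layer_sum[OF q(1)])
    fix m assume "m \<in> {1..length cs}"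
    thus "0 \<le> ?c m"
      unfolding class_liability_def using sub[of m] by (auto simp: creditors_def intro!: sum_nonneg)
  qed
  also have "\<dots> = q"
    using q(2) total_liability_classes(1)[OF N i cs] by simp
  finally show ?thesis .
qed

lemma split_payment_mono:
  assumes N: "financial_network N" and i: "i \<in> firms N" and cs: "cs \<in> strategies N i" and "q \<le> q'"
  shows "split_payment N i cs q j \<le> split_payment N i cs q' j"
proof (cases "j \<in> creditors N i")
  case True
  then obtain A where A: "A \<in> set cs" "j \<in> A"
    using cs by (auto simp: strategies_def partition_on_def)
  then obtain m where m: "m < length cs" "cs ! m = A" by (auto simp: in_set_conv_nth)
  have "class_index cs j = Suc m"
    by (rule class_index_nth[OF cs]) (use A m in auto)
  moreover have "A \<subseteq> creditors N i"
    using cs A by (auto simp: strategies_def partition_on_def)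
  ultimately have "0 \<le> class_liability N i cs (class_index cs j)"
    using m by (auto simp: class_liability_def creditors_def intro!: sum_nonneg)
  hence "0 \<le> liab N i j / class_liability N i cs (class_index cs j)"
    using True by (simp add: creditors_def)
  hence "(q - S) * (liab N i j / class_liability N i cs (class_index cs j))
     \<le> (q' - S) * (liab N i j / class_liability N i cs (class_index cs j))" for S
    using \<open>q \<le> q'\<close> by (intro mult_right_mono) auto
  thus ?thesis using True unfolding split_payment_def Let_def if_P[OF True]
    by (intro min.mono max.mono order_refl)
qed (simp add: split_payment_def)

lemma split_payment_bounds:
  assumes N: "financial_network N" and i: "i \<in> firms N" and j: "j \<in> firms N"
  shows "0 \<le> split_payment N i cs q j" "split_payment N i cs q j \<le> liab N i j"
  using assms by (auto simp: split_payment_def Let_def creditors_def financial_network_def)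

definition clearing_step ::
  "network \<Rightarrow> (nat \<Rightarrow> nat set list) \<Rightarrow> (nat \<Rightarrow> nat \<Rightarrow> real) \<Rightarrow> nat \<Rightarrow> nat \<Rightarrow> real" where
  "clearing_step N s P i j =
     (if i \<in> firms N \<and> j \<in> firms N
      then split_payment N i (s i) (min (total_liability N i) (total_assets N P i)) j else 0)"

lemma clearing_payments_iff:
  assumes N: "financial_network N" and s: "s \<in> profiles N"
  shows "clearing_payments N s P \<longleftrightarrow> clearing_step N s P = P \<and> (\<forall>i j. 0 \<le> P i j)"
proof
  assume P: "clearing_payments N s P"
  show "clearing_step N s P = P \<and> (\<forall>i j. 0 \<le> P i j)"
  proof (intro conjI ext allI)
    fix i j
    show "clearing_step N s P i j = P i j"
    proof (cases "i \<in> firms N \<and> j \<in> firms N")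
      case True
      have "0 \<le> liab N i j" using N True by (auto simp: financial_network_def)
      thus ?thesis using True P
        by (auto simp: clearing_payments_def clearing_step_def split_payment_def creditors_def Let_def)
    next
      case False
      thus ?thesis using P by (auto simp: clearing_payments_def clearing_step_def)
    qed
    show "0 \<le> P i j" using P
      by (cases "i \<in> firms N \<and> j \<in> firms N") (auto simp: clearing_payments_def)
  qed
next
  assume "clearing_step N s P = P \<and> (\<forall>i j. 0 \<le> P i j)"
  hence P: "\<And>i j. P i j = clearing_step N s P i j" and pos: "\<And>i j. 0 \<le> P i j"
    by (auto simp: fun_eq_iff)
  show "clearing_payments N s P"
    unfolding clearing_payments_def
  proof (intro conjI allI ballI impI)
    fix i j assume "i \<notin> firms N \<or> j \<notin> firms N"
    thus "P i j = 0" by (subst P) (auto simp: clearing_step_def)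
  next
    fix i assume i: "i \<in> firms N"
    have L: "0 \<le> total_liability N i"
      using N i by (auto simp: total_liability_def financial_network_def intro!: sum_nonneg)
    have a: "0 \<le> total_assets N P i"
      using N i pos by (auto simp: total_assets_def financial_network_def intro!: sum_nonneg add_nonneg_nonneg)
    let ?q = "min (total_liability N i) (total_assets N P i)"
    have st: "P i j = split_payment N i (s i) ?q j" if "j \<in> firms N" for j
      using P[of i j] i that by (simp add: clearing_step_def)
    have out: "outgoing N P i = ?q"
    proof -
      have "outgoing N P i = (\<Sum>j\<in>firms N. split_payment N i (s i) ?q j)"
        unfolding outgoing_def by (rule sum.cong) (auto simp: st)
      also have "\<dots> = ?q"
        by (rule sum_split_payment[OF N i]) (use s i L a in \<open>auto simp: profiles_def\<close>)
      finally show ?thesis .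
    qed
    show "P i i = 0" using st[OF i] N i
      by (auto simp: split_payment_def creditors_def financial_network_def)
    show "outgoing N P i = ?q" by (fact out)
    fix j
    { assume j: "j \<in> firms N"
      show "0 \<le> P i j" by (fact pos)
      show "P i j \<le> liab N i j" using st[OF j] split_payment_bounds[OF N i j] by simp }
    { assume "j \<in> firms N" "liab N i j = 0"
      thus "P i j = 0" using st[of j] by (auto simp: split_payment_def creditors_def) }
    assume j: "j \<in> creditors N i"
    show "let k = class_index (s i) j in
            P i j = min (max ((outgoing N P i - (\<Sum>m\<in>{1..<k}. class_liability N i (s i) m))
                              * (liab N i j / class_liability N i (s i) k)) 0)
                        (liab N i j)"
      using st[of j] j unfolding out by (simp add: split_payment_def creditors_def Let_def)
  qed
qed

lemma clearing_step_mono: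
  assumes N: "financial_network N" and s: "s \<in> profiles N" and le: "\<And>i j. P i j \<le> Q i j"
  shows "clearing_step N s P i j \<le> clearing_step N s Q i j"
proof (cases "i \<in> firms N \<and> j \<in> firms N")
  case True
  have "total_assets N P i \<le> total_assets N Q i"
    unfolding total_assets_def by (intro add_left_mono sum_mono le)
  hence "min (total_liability N i) (total_assets N P i)
       \<le> min (total_liability N i) (total_assets N Q i)" by auto
  thus ?thesis using True s unfolding clearing_step_def
    by (auto simp: profiles_def intro!: split_payment_mono[OF N])
qed (auto simp: clearing_step_def)

lemma proper_if_supported:
  assumes "proper N P" and mono: "\<And>i j. P i j \<le> Q i j" and pos: "\<And>i j. 0 \<le> P i j" "\<And>i j. 0 \<le> Q i j"
    and new: "\<And>i j. i \<in> firms N \<Longrightarrow> j \<in> firms N \<Longrightarrow> 0 < Q i j \<Longrightarrow> 0 < outgoing N P i \<or> 0 < ext_assets N i \<or>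
      (\<exists>h\<in>firms N. 0 < P h i)"
  shows "proper N Q"
  unfolding proper_def
proof (intro ballI impI)
  fix i assume i: "i \<in> firms N" "0 < outgoing N Q i"
  have sub: "(payment_edges N P)\<^sup>* \<subseteq> (payment_edges N Q)\<^sup>*"
    by (rule rtrancl_mono) (use mono in \<open>force simp: payment_edges_def intro: less_le_trans\<close>)
  have reach: "\<exists>h\<in>firms N. 0 < ext_assets N h \<and> (h, k) \<in> (payment_edges N P)\<^sup>*"
    if "k \<in> firms N" "0 < outgoing N P k" for k
    using assms(1) that by (auto simp: proper_def)
  have "\<exists>j\<in>firms N. 0 < Q i j"
  proof (rule ccontr)
    assume "\<not> ?thesis"
    hence "outgoing N Q i \<le> 0" unfolding outgoing_def by (intro sum_nonpos) force
    thus False using i by simp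
  qed
  then obtain j where "j \<in> firms N" "0 < Q i j" by blast
  from new[OF i(1) this]
  show "\<exists>h\<in>firms N. 0 < ext_assets N h \<and> (h, i) \<in> (payment_edges N Q)\<^sup>*"
  proof (elim disjE bexE)
    assume "0 < outgoing N P i"
    thus ?thesis using reach i sub by blast
  next
    assume "0 < ext_assets N i"
    thus ?thesis using i by blast
  next
    fix k assume k: "k \<in> firms N" "0 < P k i"
    have "0 < outgoing N P k" unfolding outgoing_def
      by (rule sum_pos2[of _ i]) (use i k pos in auto)
    then obtain h where h: "h \<in> firms N" "0 < ext_assets N h" "(h, k) \<in> (payment_edges N P)\<^sup>*"
      using reach k by blast
    moreover have "(k, i) \<in> payment_edges N P" using k i by (simp add: payment_edges_def)
    ultimately have "(h, i) \<in> (payment_edges N P)\<^sup>*" by simp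
    thus ?thesis using h sub by blast
  qed
qed

theorem maximal_payments_exist:
  assumes N: "financial_network N" and s: "s \<in> profiles N"
  shows "\<exists>!P. is_maximal_payments N s P"
proof -
  define S where "S = {P. (\<forall>i j. 0 \<le> P i j) \<and> (\<forall>i j. P i j \<le> clearing_step N s P i j) \<and> proper N P}"
  define M where "M i j = (SUP P\<in>S. P i j)" for i j
  have step_le: "clearing_step N s P i j \<le> \<bar>liab N i j\<bar>" for P i j
    using split_payment_bounds(2)[OF N, of i j "s i"]
    by (auto simp: clearing_step_def intro: order_trans[OF _ abs_ge_self])
  have step_nn: "0 \<le> clearing_step N s P i j" for P i j
    using split_payment_bounds(1)[OF N] by (auto simp: clearing_step_def)
  have bdd: "bdd_above ((\<lambda>P. P i j) ` S)" for i j
  proof (rule bdd_aboveI2[where M = "\<bar>liab N i j\<bar>"])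
    fix P assume "P \<in> S"
    hence "P i j \<le> clearing_step N s P i j" by (simp add: S_def)
    thus "P i j \<le> \<bar>liab N i j\<bar>" using step_le by (rule order_trans)
  qed
  have zero: "(\<lambda>_ _. 0) \<in> S"
    by (auto simp: S_def step_nn proper_def outgoing_def)
  have le_M: "P i j \<le> M i j" if "P \<in> S" for P i j
    unfolding M_def using that bdd by (rule cSUP_upper)
  have M_nn: "0 \<le> M i j" for i j using le_M[OF zero] by simp
  have M_step: "M i j \<le> clearing_step N s M i j" for i j
    unfolding M_def[of i j]
  proof (rule cSUP_least)
    show "S \<noteq> {}" using zero by blast
  next
    fix P assume P: "P \<in> S"
    have "P i j \<le> clearing_step N s P i j" using P by (simp add: S_def)
    also have "\<dots> \<le> clearing_step N s M i j"
      by (rule clearing_step_mono[OF N s]) (rule le_M[OF P])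
    finally show "P i j \<le> clearing_step N s M i j" .
  qed
  have M_proper: "proper N M"
    unfolding proper_def
  proof (intro ballI impI)
    fix i assume i: "i \<in> firms N" "0 < outgoing N M i"
    have "\<exists>j\<in>firms N. 0 < M i j"
    proof (rule ccontr)
      assume "\<not> ?thesis"
      hence "outgoing N M i \<le> 0" unfolding outgoing_def by (intro sum_nonpos) force
      thus False using i by simp
    qed
    then obtain j where j: "j \<in> firms N" "0 < M i j" by blast
    have "\<exists>P\<in>S. 0 < P i j"
      using j zero less_cSUP_iff[OF _ bdd, of 0 i j] unfolding M_def by blast
    then obtain P where P: "P \<in> S" "0 < P i j" by blast
    have "0 < outgoing N P i" unfolding outgoing_def
      by (rule sum_pos2[of _ j]) (use j P in \<open>auto simp: S_def\<close>)
    then obtain h where h: "h \<in> firms N" "0 < ext_assets N h" "(h, i) \<in> (payment_edges N P)\<^sup>*"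
      using P i by (auto simp: S_def proper_def)
    have "(payment_edges N P)\<^sup>* \<subseteq> (payment_edges N M)\<^sup>*"
      by (rule rtrancl_mono)
         (use le_M[OF P(1)] in \<open>force simp: payment_edges_def intro: less_le_trans\<close>)
    thus "\<exists>h\<in>firms N. 0 < ext_assets N h \<and> (h, i) \<in> (payment_edges N M)\<^sup>*"
      using h by blast
  qed
  have "proper N (clearing_step N s M)"
  proof (rule proper_if_supported[OF M_proper M_step M_nn step_nn])
    fix i j assume ij: "i \<in> firms N" "j \<in> firms N" "0 < clearing_step N s M i j"
    show "0 < outgoing N M i \<or> 0 < ext_assets N i \<or> (\<exists>h\<in>firms N. 0 < M h i)"
    proof (rule ccontr)
      assume neg: "\<not> ?thesis"
      have cs: "s i \<in> strategies N i" using s ij by (auto simp: profiles_def)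
      have "ext_assets N i = 0" using N neg ij by (force simp: financial_network_def)
      moreover have "(\<Sum>h\<in>firms N. M h i) = 0"
        by (rule sum.neutral) (use neg M_nn in \<open>force intro: order_antisym\<close>)
      ultimately have a: "total_assets N M i = 0" by (simp add: total_assets_def)
      have L: "0 \<le> total_liability N i"
        using N ij by (auto simp: total_liability_def financial_network_def intro!: sum_nonneg)
      hence "(\<Sum>j\<in>firms N. split_payment N i (s i) 0 j) = 0"
        by (intro sum_split_payment[OF N ij(1) cs]) auto
      hence "split_payment N i (s i) 0 j = 0"
        using split_payment_bounds(1)[OF N ij(1)] ij
        by (subst (asm) sum_nonneg_eq_0_iff) auto
      thus False using ij a L by (simp add: clearing_step_def)
    qed
  qed
  hence "clearing_step N s M \<in> S"
    using step_nn clearing_step_mono[OF N s M_step] by (simp add: S_def)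
  hence "clearing_step N s M i j \<le> M i j" for i j by (rule le_M)
  hence "clearing_step N s M = M" using M_step by (intro ext antisym) auto
  hence "clearing_payments N s M"
    using M_nn clearing_payments_iff[OF N s] by blast
  moreover have "Q i j \<le> M i j" if "clearing_payments N s Q" "proper N Q" for Q i j
    by (rule le_M) (use that clearing_payments_iff[OF N s, of Q] in \<open>auto simp: S_def\<close>)
  ultimately have "is_maximal_payments N s M"
    using M_proper by (auto simp: is_maximal_payments_def)
  thus ?thesis using is_maximal_payments_unique by blast
qed

corollary is_maximal_payments_maximal_payments:
  assumes "financial_network N" and "s \<in> profiles N"
  shows "is_maximal_payments N s (maximal_payments N s)"
  unfolding maximal_payments_def by (rule theI'[OF maximal_payments_exist[OF assms]])

definition utility :: "network \<Rightarrow> (nat \<Rightarrow> nat set list) \<Rightarrow> nat \<Rightarrow> real" where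
  "utility N s i = total_assets N (maximal_payments N s) i"

definition nash_equilibrium :: "network \<Rightarrow> (nat \<Rightarrow> nat set list) \<Rightarrow> bool" where
  "nash_equilibrium N s \<longleftrightarrow>
     s \<in> profiles N \<and>
     (\<forall>i\<in>firms N. \<forall>t\<in>strategies N i. utility N (s(i := t)) i \<le> utility N s i)"

end

theory Submission imports Defs begin

text \<open>In a network of five firms only firms 2 and 3 have more than one creditor, hence more than one
  strategy. Firm 2 gets part of its money back when it pays firm 4, which returns at most 2, and
  the rest only through firm 3 and firm 1; firm 3 gets money back from firm 5, at most 2, and
  otherwise only through firms 1 and 2. In each of the nine profiles the clearing equations
  determine the assets of firms 2 and 3, so maximality and properness play no role. The best
  responses form a cycle: against a strict ranking of firm 3, firm 2 ranks firm 4 first; against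
  this, firm 3 ties its creditors; against the tie, firm 2 ties as well; and against that, firm 3
  ranks firm 1 first.\<close>

section \<open>Strategies of a firm with one or two creditors\<close>

lemma strategies_singleton:
  assumes "creditors N i = {a}"
  shows "strategies N i = {[{a}]}"
proof -
  have "cs = [{a}]" if "distinct cs" "partition_on {a} (set cs)" for cs
  proof -
    have "set cs \<subseteq> {{a}}"
    proof
      fix X assume "X \<in> set cs"
      hence "X \<subseteq> {a}" "X \<noteq> {}" using that(2) by (auto simp: partition_on_def)
      thus "X \<in> {{a}}" by blast
    qed
    moreover have "set cs \<noteq> {}" using that(2) by (auto simp: partition_on_def)
    ultimately have "set cs = {{a}}" by (metis subset_singletonD)
    moreover from this have "length cs = Suc 0" using distinct_card[OF that(1)] by simp
    then obtain X where "cs = [X]" by (auto simp: length_Suc_conv)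
    ultimately show ?thesis by simp
  qed
  moreover have "partition_on {a} {{a}}" by (simp add: partition_on_def disjoint_def)
  ultimately show ?thesis using assms by (auto simp: strategies_def)
qed

text \<open>Every block is nonempty, so it meets the block of \<open>a\<close> or that of
  \<open>b\<close> and equals it. These two blocks either coincide or are disjoint
  singletons.\<close>

lemma partition_on_pair:
  assumes "partition_on {a, b} P" "a \<noteq> b"
  shows "P = {{a, b}} \<or> P = {{a}, {b}}"
proof -
  have union: "\<Union>P = {a, b}" and disj: "disjoint P"
    using assms(1) by (simp_all add: partition_on_def)
  obtain A B where AB: "A \<in> P" "a \<in> A" "B \<in> P" "b \<in> B"
    using union by blast
  have sub: "A \<subseteq> {a, b}" "B \<subseteq> {a, b}" using union AB by blast+
  have "X \<in> {A, B}" if X: "X \<in> P" for X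
  proof -
    have "X \<subseteq> {a, b}" "X \<noteq> {}" using assms(1) X by (auto simp: partition_on_def)
    hence "a \<in> X \<or> b \<in> X" by auto
    thus ?thesis
    proof
      assume "a \<in> X"
      hence "X \<inter> A \<noteq> {}" using AB(2) by auto
      thus ?thesis using disjointD[OF disj X AB(1)] by blast
    next
      assume "b \<in> X"
      hence "X \<inter> B \<noteq> {}" using AB(4) by auto
      thus ?thesis using disjointD[OF disj X AB(3)] by blast
    qed
  qed
  hence P: "P = {A, B}" using AB(1,3) by auto
  show ?thesis
  proof (cases "A = B")
    case True
    hence "A = {a, b}" using sub(1) AB(2,4) by auto
    thus ?thesis using P True by simp
  next
    case False
    hence "A \<inter> B = {}" by (rule disjointD[OF disj AB(1,3)])
    hence "A = {a}" "B = {b}" using sub AB(2,4) by auto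
    thus ?thesis using P by simp
  qed
qed

lemma strategies_pair:
  assumes "creditors N i = {a, b}" "a \<noteq> b"
  shows "strategies N i = {[{a}, {b}], [{b}, {a}], [{a, b}]}"
proof -
  have "cs \<in> {[{a}, {b}], [{b}, {a}], [{a, b}]}"
    if "distinct cs" "partition_on {a, b} (set cs)" for cs
  proof -
    have len: "length cs = card (set cs)" using that(1) by (simp add: distinct_card)
    from partition_on_pair[OF that(2) assms(2)] show ?thesis
    proof
      assume set: "set cs = {{a, b}}"
      then obtain X where "cs = [X]" using len by (auto simp: length_Suc_conv)
      thus ?thesis using set by simp
    next
      assume set: "set cs = {{a}, {b}}"
      moreover have "{a} \<noteq> {b}" using assms(2) by simp
      ultimately have "length cs = Suc (Suc 0)" using len by simp
      then obtain X Y where "cs = [X, Y]" by (auto simp: length_Suc_conv)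
      thus ?thesis using set by (auto simp: doubleton_eq_iff)
    qed
  qed
  moreover have "partition_on {a, b} {{a}, {b}}" "partition_on {a, b} {{b}, {a}}"
    "partition_on {a, b} {{a, b}}"
    using assms(2) by (auto simp: partition_on_def disjoint_def)
  ultimately show ?thesis using assms by (auto simp: strategies_def)
qed

section \<open>Payments in closed form\<close>

text \<open>Trades the definite description in \<open>class_index\<close> for a position counted
  from 0, so that payments under concrete lists can be computed by simplification.\<close>

lemma split_payment_nth:
  assumes cs: "cs \<in> strategies N i" and m: "m < length cs" and j: "j \<in> cs ! m"
  shows "split_payment N i cs q j =
    min (max ((q - (\<Sum>n<m. \<Sum>k\<in>cs ! n. liab N i k)) * (liab N i j / (\<Sum>k\<in>cs ! m. liab N i k))) 0)
        (liab N i j)"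
proof -
  have "class_index cs j = Suc m"
    by (rule class_index_nth[OF cs]) (use m j in auto)
  moreover have "j \<in> creditors N i"
    using cs m j by (auto simp: strategies_def partition_on_def)
  moreover have "(\<Sum>n\<in>{1..<Suc m}. class_liability N i cs n) = (\<Sum>n<m. class_liability N i cs (Suc n))"
    by (rule sum.reindex_bij_witness[of _ Suc "\<lambda>n. n - 1"]) auto
  ultimately show ?thesis
    by (simp add: split_payment_def class_liability_def)
qed

lemma split_payment_singleton:
  assumes "creditors N i = {a}" "0 \<le> q"
  shows "split_payment N i [{a}] q a = min q (liab N i a)"
proof -
  have "0 < liab N i a" using assms(1) by (auto simp: creditors_def)
  thus ?thesis
    using split_payment_nth[of "[{a}]" N i 0 a q] strategies_singleton[OF assms(1)] assms(2)
    by simp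
qed

lemma split_payment_ranked:
  assumes "creditors N i = {a, b}" "a \<noteq> b" "0 \<le> q"
  shows "split_payment N i [{a}, {b}] q a = min q (liab N i a)"
    and "split_payment N i [{a}, {b}] q b = min (max (q - liab N i a) 0) (liab N i b)"
proof -
  have "0 < liab N i a" "0 < liab N i b" using assms(1) by (auto simp: creditors_def)
  moreover have "[{a}, {b}] \<in> strategies N i" using strategies_pair[OF assms(1,2)] by simp
  ultimately show "split_payment N i [{a}, {b}] q a = min q (liab N i a)"
    "split_payment N i [{a}, {b}] q b = min (max (q - liab N i a) 0) (liab N i b)"
    using split_payment_nth[of "[{a}, {b}]" N i 0 a q] split_payment_nth[of "[{a}, {b}]" N i 1 b q]
      assms(3) by simp_all
qed

text \<open>As \<open>q\<close> does not exceed the total debt, neither truncation binds and the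
  proportional share remains.\<close>

lemma split_payment_tied:
  assumes "creditors N i = {a, b}" "a \<noteq> b" "0 \<le> q" "q \<le> liab N i a + liab N i b" "c \<in> {a, b}"
  shows "split_payment N i [{a, b}] q c = q * liab N i c / (liab N i a + liab N i b)"
proof -
  have pos: "0 < liab N i a" "0 < liab N i b" using assms(1) by (auto simp: creditors_def)
  have "[{a, b}] \<in> strategies N i" using strategies_pair[OF assms(1,2)] by simp
  hence "split_payment N i [{a, b}] q c
      = min (max (q * (liab N i c / (liab N i a + liab N i b))) 0) (liab N i c)"
    using split_payment_nth[of "[{a, b}]" N i 0 c q] assms(2,5) by simp
  moreover have "0 \<le> q * (liab N i c / (liab N i a + liab N i b))"
    using assms pos by auto
  moreover have "q * (liab N i c / (liab N i a + liab N i b)) \<le> liab N i c"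
    using assms(4,5) pos mult_right_mono[OF assms(4), of "liab N i c"]
    by (auto simp: field_simps)
  ultimately show ?thesis by simp
qed

section \<open>The network and its clearing equations\<close>

text \<open>The liabilities form the long cycle through 1, 2, 3 and two short ones, between 2 and 4
  and between 3 and 5. The debts of firms 4 and 5 cap the direct returns at 2, that of firm 1 caps
  the return to firm 2 along the long cycle at 4.\<close>

definition cyclic_network :: network where
  "cyclic_network =
     \<lparr>num_firms = 5,
      ext_assets = (\<lambda>i. if i = 1 then 1 else if i = 3 then 2 else 0),
      liab = (\<lambda>i j.
        if (i, j) = (1, 2) then 4 else
        if (i, j) = (2, 3) then 9 else
        if (i, j) = (2, 4) then 4 else
        if (i, j) = (3, 1) then 5 else
        if (i, j) = (3, 5) then 10 else
        if (i, j) = (4, 2) then 2 else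
        if (i, j) = (5, 3) then 2 else 0)\<rparr>"

lemma firms_cyclic_network: "firms cyclic_network = {1, 2, 3, 4, 5}"
  by (auto simp: firms_def cyclic_network_def)

lemma financial_network_cyclic_network: "financial_network cyclic_network"
  by (auto simp: financial_network_def cyclic_network_def)

lemma creditors_cyclic_network:
  "creditors cyclic_network 1 = {2}"
  "creditors cyclic_network 2 = {3, 4}"
  "creditors cyclic_network 3 = {5, 1}"
  "creditors cyclic_network 4 = {2}"
  "creditors cyclic_network 5 = {3}"
  unfolding creditors_def firms_cyclic_network by (auto simp: cyclic_network_def)

lemma liab_cyclic_network:
  "liab cyclic_network 1 2 = 4"
  "liab cyclic_network 2 3 = 9"
  "liab cyclic_network 2 4 = 4"
  "liab cyclic_network 3 1 = 5"
  "liab cyclic_network 3 5 = 10"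
  "liab cyclic_network 4 2 = 2"
  "liab cyclic_network 5 3 = 2"
  by (simp_all add: cyclic_network_def)

lemma strategies_cyclic_network:
  "strategies cyclic_network 1 = {[{2}]}"
  "strategies cyclic_network 2 = {[{3}, {4}], [{4}, {3}], [{3, 4}]}"
  "strategies cyclic_network 3 = {[{5}, {1}], [{1}, {5}], [{5, 1}]}"
  "strategies cyclic_network 4 = {[{2}]}"
  "strategies cyclic_network 5 = {[{3}]}"
  by (simp_all add: strategies_singleton strategies_pair creditors_cyclic_network del: One_nat_def)

text \<open>Firms 1, 4 and 5 have one creditor each, so their payments can be eliminated. This
  leaves a system in the assets of firms 2 and 3 alone.\<close>

lemma utility_equations:
  defines "N \<equiv> cyclic_network"
  assumes s: "s \<in> profiles N"
  defines "x \<equiv> utility N s 2" and "y \<equiv> utility N s 3"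
  defines "p \<equiv> split_payment N 2 (s 2) x" and "q \<equiv> split_payment N 3 (s 3) y"
  shows "0 \<le> x" "x \<le> 6" "0 \<le> y" "y \<le> 13"
    "x = min (1 + q 1) 4 + min (p 4) 2"
    "y = 2 + p 3 + min (q 5) 2"
proof -
  define P where "P = maximal_payments N s"
  have N: "financial_network N"
    unfolding N_def by (rule financial_network_cyclic_network)
  have "clearing_payments N s P"
    using is_maximal_payments_maximal_payments[OF N s]
    by (simp add: P_def is_maximal_payments_def)
  hence step: "clearing_step N s P = P" and P_nonneg: "0 \<le> P i j" for i j
    using clearing_payments_iff[OF N s] by auto
  have fN: "firms N = {1, 2, 3, 4, 5}" unfolding N_def by (rule firms_cyclic_network)
  have P: "P i j = split_payment N i (s i) (min (total_liability N i) (total_assets N P i)) j"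
    if "i \<in> firms N" "j \<in> firms N" for i j
    using that fun_cong[OF fun_cong[OF step], of i j] by (simp add: clearing_step_def)
  have L: "total_liability N 1 = 4" "total_liability N 2 = 13" "total_liability N 3 = 15"
    "total_liability N 4 = 2" "total_liability N 5 = 2"
    unfolding total_liability_def fN by (simp_all add: N_def cyclic_network_def)
  \<comment> \<open>Payments run only along debts, so the incoming sums below collapse to at most
    two terms.\<close>
  have no_liab: "P i j = 0" if "j \<notin> creditors N i" for i j
    using fun_cong[OF fun_cong[OF step], of i j] that
    by (auto simp: clearing_step_def split_payment_def split: if_splits)
  note cred = creditors_cyclic_network[folded N_def] and liab = liab_cyclic_network[folded N_def]
  have a: "total_assets N P 1 = 1 + P 3 1" "total_assets N P 2 = P 1 2 + P 4 2"
    "total_assets N P 3 = 2 + P 2 3 + P 5 3" "total_assets N P 4 = P 2 4" "total_assets N P 5 = P 3 5"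
    unfolding total_assets_def fN
    by (simp_all add: no_liab cred del: One_nat_def) (simp_all add: N_def cyclic_network_def)
  have xy: "x = total_assets N P 2" "y = total_assets N P 3"
    by (simp_all add: x_def y_def utility_def P_def)
  have s_eq: "s 1 = [{2}]" "s 4 = [{2}]" "s 5 = [{3}]"
    using s strategies_cyclic_network[folded N_def] by (auto simp: profiles_def fN)
  have clear: "P 1 2 = min (1 + P 3 1) 4" "P 4 2 = min (P 2 4) 2" "P 5 3 = min (P 3 5) 2"
    using P[of 1 2] P[of 4 2] P[of 5 3] P_nonneg[of 3 1] P_nonneg[of 2 4] P_nonneg[of 3 5]
    by (simp_all add: fN s_eq split_payment_singleton cred liab L a min.commute del: One_nat_def)
  \<comment> \<open>The other payments into firms 2 and 3 are capped by \<open>clear\<close>; the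
    bounds are 6 = 4 + 2 and 13 = 2 + 9 + 2.\<close>
  have "P 2 3 \<le> 9"
    using P[of 2 3] split_payment_bounds(2)[OF N, of 2 3] by (simp add: fN liab)
  with clear show bounds: "0 \<le> x" "x \<le> 6" "0 \<le> y" "y \<le> 13"
    using P_nonneg[of 1 2] P_nonneg[of 4 2] P_nonneg[of 2 3] P_nonneg[of 5 3]
    by (simp_all add: xy a)
  \<comment> \<open>Assets of at most 6 and 13 are below the debts 13 and 15, so firms 2 and 3 pay
    out all they have.\<close>
  have "P 2 3 = p 3" "P 2 4 = p 4" "P 3 1 = q 1" "P 3 5 = q 5"
    using P[of 2 3] P[of 2 4] P[of 3 1] P[of 3 5] bounds by (simp_all add: fN L p_def q_def xy)
  with clear show "x = min (1 + q 1) 4 + min (p 4) 2" "y = 2 + p 3 + min (q 5) 2"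
    by (simp_all add: xy a)
qed

section \<open>Utilities in the nine profiles\<close>

lemma split_payment_firm2:
  assumes "0 \<le> q" "q \<le> 9"
  shows
    "split_payment cyclic_network 2 [{3}, {4}] q 3 = q"
    "split_payment cyclic_network 2 [{3}, {4}] q 4 = 0"
    "split_payment cyclic_network 2 [{4}, {3}] q 4 = min q 4"
    "split_payment cyclic_network 2 [{4}, {3}] q 3 = max (q - 4) 0"
    "split_payment cyclic_network 2 [{3, 4}] q 3 = q * 9 / 13"
    "split_payment cyclic_network 2 [{3, 4}] q 4 = q * 4 / 13"
proof -
  note l = liab_cyclic_network
  \<comment> \<open>Both enumerations of the set are kept because
    \<open>split_payment_ranked\<close> serves the first-named creditor first.\<close>
  have c: "creditors cyclic_network 2 = {3, 4}" "creditors cyclic_network 2 = {4, 3}"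
    using creditors_cyclic_network by auto
  show "split_payment cyclic_network 2 [{3}, {4}] q 3 = q"
    "split_payment cyclic_network 2 [{3}, {4}] q 4 = 0"
    using split_payment_ranked[OF c(1) _ assms(1)] l assms by simp_all
  show "split_payment cyclic_network 2 [{4}, {3}] q 4 = min q 4"
    "split_payment cyclic_network 2 [{4}, {3}] q 3 = max (q - 4) 0"
    using split_payment_ranked[OF c(2) _ assms(1)] l assms by simp_all
  show "split_payment cyclic_network 2 [{3, 4}] q 3 = q * 9 / 13"
    "split_payment cyclic_network 2 [{3, 4}] q 4 = q * 4 / 13"
    using split_payment_tied[OF c(1) _ assms(1), of 3] split_payment_tied[OF c(1) _ assms(1), of 4]
      l assms by simp_all
qed

lemma split_payment_firm3:
  assumes "0 \<le> q" "q \<le> 15"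
  shows
    "split_payment cyclic_network 3 [{5}, {1}] q 5 = min q 10"
    "split_payment cyclic_network 3 [{5}, {1}] q 1 = max (q - 10) 0"
    "split_payment cyclic_network 3 [{1}, {5}] q 1 = min q 5"
    "split_payment cyclic_network 3 [{1}, {5}] q 5 = max (q - 5) 0"
    "split_payment cyclic_network 3 [{5, 1}] q 5 = q * 10 / 15"
    "split_payment cyclic_network 3 [{5, 1}] q 1 = q * 5 / 15"
proof -
  note l = liab_cyclic_network
  have c: "creditors cyclic_network 3 = {5, 1}" "creditors cyclic_network 3 = {1, 5}"
    using creditors_cyclic_network by auto
  show "split_payment cyclic_network 3 [{5}, {1}] q 5 = min q 10"
    "split_payment cyclic_network 3 [{5}, {1}] q 1 = max (q - 10) 0"
    using split_payment_ranked[OF c(1) _ assms(1)] l assms by simp_all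
  show "split_payment cyclic_network 3 [{1}, {5}] q 1 = min q 5"
    "split_payment cyclic_network 3 [{1}, {5}] q 5 = max (q - 5) 0"
    using split_payment_ranked[OF c(2) _ assms(1)] l assms by simp_all
  show "split_payment cyclic_network 3 [{5, 1}] q 5 = q * 10 / 15"
    "split_payment cyclic_network 3 [{5, 1}] q 1 = q * 5 / 15"
    using split_payment_tied[OF c(1) _ assms(1), of 5] split_payment_tied[OF c(1) _ assms(1), of 1]
      l assms by simp_all
qed

text \<open>Each pair of strategies turns \<open>utility_equations\<close> into two piecewise linear
  equations. Splitting the minima and maxima leaves a single solution.\<close>

lemma utility_table:
  defines "u \<equiv> utility cyclic_network"
  assumes s: "s \<in> profiles cyclic_network"
  shows
    "s 2 = [{3}, {4}] \<Longrightarrow> s 3 = [{5}, {1}] \<Longrightarrow> u s 2 = 1 \<and> u s 3 = 5"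
    "s 2 = [{4}, {3}] \<Longrightarrow> s 3 = [{5}, {1}] \<Longrightarrow> u s 2 = 3 \<and> u s 3 = 4"
    "s 2 = [{3, 4}] \<Longrightarrow> s 3 = [{5}, {1}] \<Longrightarrow> u s 2 = 13 / 9 \<and> u s 3 = 5"
    "s 2 = [{3}, {4}] \<Longrightarrow> s 3 = [{1}, {5}] \<Longrightarrow> u s 2 = 4 \<and> u s 3 = 8"
    "s 2 = [{4}, {3}] \<Longrightarrow> s 3 = [{1}, {5}] \<Longrightarrow> u s 2 = 6 \<and> u s 3 = 4"
    "s 2 = [{3, 4}] \<Longrightarrow> s 3 = [{1}, {5}] \<Longrightarrow> u s 2 = 52 / 9 \<and> u s 3 = 8"
    "s 2 = [{3}, {4}] \<Longrightarrow> s 3 = [{5, 1}] \<Longrightarrow> u s 2 = 7 / 2 \<and> u s 3 = 15 / 2"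
    "s 2 = [{4}, {3}] \<Longrightarrow> s 3 = [{5, 1}] \<Longrightarrow> u s 2 = 9 / 2 \<and> u s 3 = 9 / 2"
    "s 2 = [{3, 4}] \<Longrightarrow> s 3 = [{5, 1}] \<Longrightarrow> u s 2 = 91 / 18 \<and> u s 3 = 15 / 2"
proof -
  note e = utility_equations[OF s, folded u_def]
  \<comment> \<open>These are the ranges in which the closed forms hold.\<close>
  have "u s 2 \<le> 9" "u s 3 \<le> 15" using e(2,4) by simp_all
  note x = split_payment_firm2[OF e(1) this(1)] and y = split_payment_firm3[OF e(3) this(2)]
  show "u s 2 = 1 \<and> u s 3 = 5" if c: "s 2 = [{3}, {4}]" "s 3 = [{5}, {1}]"
    using e(1-4) e(5,6)[unfolded c x(1,2) y(1,2)] by (intro conjI; linarith)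
  show "u s 2 = 3 \<and> u s 3 = 4" if c: "s 2 = [{4}, {3}]" "s 3 = [{5}, {1}]"
    using e(1-4) e(5,6)[unfolded c x(3,4) y(1,2)] by (intro conjI; linarith)
  show "u s 2 = 13 / 9 \<and> u s 3 = 5" if c: "s 2 = [{3, 4}]" "s 3 = [{5}, {1}]"
    using e(1-4) e(5,6)[unfolded c x(5,6) y(1,2)] by (intro conjI; linarith)
  show "u s 2 = 4 \<and> u s 3 = 8" if c: "s 2 = [{3}, {4}]" "s 3 = [{1}, {5}]"
    using e(1-4) e(5,6)[unfolded c x(1,2) y(3,4)] by (intro conjI; linarith)
  show "u s 2 = 6 \<and> u s 3 = 4" if c: "s 2 = [{4}, {3}]" "s 3 = [{1}, {5}]"
    using e(1-4) e(5,6)[unfolded c x(3,4) y(3,4)] by (intro conjI; linarith)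
  show "u s 2 = 52 / 9 \<and> u s 3 = 8" if c: "s 2 = [{3, 4}]" "s 3 = [{1}, {5}]"
    using e(1-4) e(5,6)[unfolded c x(5,6) y(3,4)] by (intro conjI; linarith)
  show "u s 2 = 7 / 2 \<and> u s 3 = 15 / 2" if c: "s 2 = [{3}, {4}]" "s 3 = [{5, 1}]"
    using e(1-4) e(5,6)[unfolded c x(1,2) y(5,6)] by (intro conjI; linarith)
  show "u s 2 = 9 / 2 \<and> u s 3 = 9 / 2" if c: "s 2 = [{4}, {3}]" "s 3 = [{5, 1}]"
    using e(1-4) e(5,6)[unfolded c x(3,4) y(5,6)] by (intro conjI; linarith)
  show "u s 2 = 91 / 18 \<and> u s 3 = 15 / 2" if c: "s 2 = [{3, 4}]" "s 3 = [{5, 1}]"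
    using e(1-4) e(5,6)[unfolded c x(5,6) y(5,6)] by (intro conjI; linarith)
qed

section \<open>The cycle of best responses\<close>

theorem theorem4:
  shows "\<exists>N. financial_network N \<and> \<not> (\<exists>s. nash_equilibrium N s)"
proof (intro exI conjI notI)
  show "financial_network cyclic_network" by (rule financial_network_cyclic_network)
next
  let ?N = cyclic_network
  assume "\<exists>s. nash_equilibrium ?N s"
  then obtain s where s: "s \<in> profiles ?N"
    and best: "\<And>i t. i \<in> firms ?N \<Longrightarrow> t \<in> strategies ?N i \<Longrightarrow>
      utility ?N (s(i := t)) i \<le> utility ?N s i"
    by (auto simp: nash_equilibrium_def)
  have dev: "s(i := t) \<in> profiles ?N" if "t \<in> strategies ?N i" for i t
    using s that by (auto simp: profiles_def)
  have firm2: "utility ?N (s(2 := t)) 2 \<le> utility ?N s 2" "s(2 := t) \<in> profiles ?N"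
    if "t \<in> {[{4}, {3}], [{3, 4}]}" for t
    using that best[of 2 t] dev[of t 2]
    by (auto simp: strategies_cyclic_network firms_cyclic_network)
  have firm3: "utility ?N (s(3 := t)) 3 \<le> utility ?N s 3" "s(3 := t) \<in> profiles ?N"
    if "t \<in> {[{1}, {5}], [{5, 1}]}" for t
    using that best[of 3 t] dev[of t 3]
    by (auto simp: strategies_cyclic_network firms_cyclic_network)
  note s_table = utility_table[OF s]
  \<comment> \<open>Each collection joins the equilibrium inequality for one deviation with the
    utilities after it; the numbers then contradict each other.\<close>
  note to_4 = firm2(1)[of "[{4}, {3}]"] utility_table[OF firm2(2)[of "[{4}, {3}]"]]
  note to_34 = firm2(1)[of "[{3, 4}]"] utility_table[OF firm2(2)[of "[{3, 4}]"]]
  note to_1 = firm3(1)[of "[{1}, {5}]"] utility_table[OF firm3(2)[of "[{1}, {5}]"]]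
  note to_51 = firm3(1)[of "[{5, 1}]"] utility_table[OF firm3(2)[of "[{5, 1}]"]]
  have "s 2 \<in> {[{3}, {4}], [{4}, {3}], [{3, 4}]}" "s 3 \<in> {[{5}, {1}], [{1}, {5}], [{5, 1}]}"
    using s unfolding strategies_cyclic_network[symmetric]
    by (auto simp: profiles_def firms_cyclic_network)
  then consider
    "s 2 \<in> {[{3}, {4}], [{3, 4}]}" "s 3 \<in> {[{5}, {1}], [{1}, {5}]}"
    | "s 2 = [{3}, {4}]" "s 3 = [{5, 1}]"
    | "s 2 = [{4}, {3}]" "s 3 \<in> {[{5}, {1}], [{1}, {5}]}"
    | "s 2 = [{4}, {3}]" "s 3 = [{5, 1}]"
    | "s 2 = [{3, 4}]" "s 3 = [{5, 1}]"
    by blast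
  thus False
  proof cases
    case 1
    \<comment> \<open>By ranking firm 4 first, firm 2 gets 3 instead of 1 or 13/9, and 6 instead of
      4 or 52/9.\<close>
    thus ?thesis using to_4 s_table by auto
  next
    case 2
    \<comment> \<open>The same deviation raises 7/2 to 9/2.\<close>
    thus ?thesis using to_4 s_table by auto
  next
    case 3
    \<comment> \<open>The tie raises 4 to 9/2: firm 5 gets 3 and returns the full 2, while the 3/2
      sent to firm 1 makes firm 2 pass 1/2 on to firm 3.\<close>
    thus ?thesis using to_51 s_table by auto
  next
    case 4
    \<comment> \<open>The tie raises 9/2 to 91/18: firm 4 returns 14/9 instead of 2, but firm 1 now
      pays 7/2 instead of 5/2.\<close>
    thus ?thesis using to_34 s_table by auto
  next
    case 5
    \<comment> \<open>Firm 3 raises 15/2 to 8: firm 1 then pays its full debt 4, and the 3 left for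
      firm 5 still brings back 2.\<close>
    thus ?thesis using to_1 s_table by auto
  qed
qed

end
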